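(* Each orbit of the action of $B_4$ on $\mathbb{P}^2(\mathbb{Q})$ through the integral reduced Burau representation $\rho$, except for the singleton orbit $\{[1:0:1]\}$, is dense in $\mathbb{P}^2(\mathbb{Q})$.
   Context: $B_4$ is the braid group generated by $\sigma_1,\sigma_2,\sigma_3$ with relations $\sigma_1\sigma_2\sigma_1=\sigma_2\sigma_1\sigma_2$, $\sigma_2\sigma_3\sigma_2=\sigma_3\sigma_2\sigma_3$, $\sigma_1\sigma_3=\sigma_3\sigma_1$. The integral reduced Burau representation $\rho:B_4\to\mathrm{SL}_3(\mathbb{Z})$ acts on $\mathbb{P}^2(\mathbb{Q})$ by $\rho(\sigma_1):[r:s:t]\mapsto[r+s:s:t]$, $\rho(\sigma_2):[r:s:t]\mapsto[r:s+t-r:t]$, $\rho(\sigma_3):[r:s:t]\mapsto[r:s:t-s]$. The point $[1:0:1]$ is fixed by this action. The topology on $\mathbb{P}^2(\mathbb{Q})$ is the one induced by the standard embedding $\mathbb{P}^2(\mathbb{Q})\subset\mathbb{P}^2(\mathbb{R})$, with the usual topology on $\mathbb{P}^2(\mathbb{R})$ coming from the Euclidean norm on $\mathbb{R}^3$. *)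

theory Defs
  imports "HOL-Analysis.Analysis" "HOL-Algebra.Group_Action"
begin

datatype gen4 = S1 | S2 | S3

text \<open>The letter \<open>(s, True)\<close> stands for the generator \<open>s\<close>, and \<open>(s, False)\<close> for its formal inverse.\<close>

type_synonym word4 = "(gen4 \<times> bool) list"

inductive braid_eq :: "word4 \<Rightarrow> word4 \<Rightarrow> bool" where
  refl: "braid_eq u u"
| sym: "braid_eq u v \<Longrightarrow> braid_eq v u"
| trans: "braid_eq u v \<Longrightarrow> braid_eq v w \<Longrightarrow> braid_eq u w"
| append: "braid_eq u u' \<Longrightarrow> braid_eq v v' \<Longrightarrow> braid_eq (u @ v) (u' @ v')"
| cancel: "braid_eq [(s, b), (s, \<not> b)] []"
| braid12: "braid_eq [(S1, True), (S2, True), (S1, True)] [(S2, True), (S1, True), (S2, True)]"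
| braid23: "braid_eq [(S2, True), (S3, True), (S2, True)] [(S3, True), (S2, True), (S3, True)]"
| comm13: "braid_eq [(S1, True), (S3, True)] [(S3, True), (S1, True)]"

quotient_type braid4 = word4 / braid_eq
  by (rule equivpI) (auto intro!: reflpI sympI transpI intro: braid_eq.refl braid_eq.sym braid_eq.trans)

lift_definition braid_mult :: "braid4 \<Rightarrow> braid4 \<Rightarrow> braid4" is "(@)"
  by (rule braid_eq.append)

lift_definition braid_one :: braid4 is "[]" .

lift_definition braid_gen :: "gen4 \<Rightarrow> braid4" is "\<lambda>s. [(s, True)]" .

definition B4 :: "braid4 monoid" where
  "B4 = \<lparr>carrier = UNIV, mult = braid_mult, one = braid_one\<rparr>"

lemma braid_eq_inverse: "braid_eq (map (\<lambda>(s, b). (s, \<not> b)) (rev w) @ w) []"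
proof (induction w)
  case Nil
  show ?case by (simp add: braid_eq.refl)
next
  case (Cons a w)
  obtain s b where a: "a = (s, b)" by fastforce
  let ?v = "map (\<lambda>(s, b). (s, \<not> b)) (rev w)"
  have "braid_eq [(s, \<not> b), (s, b)] []"
    using braid_eq.cancel[of s "\<not> b"] by simp
  then have "braid_eq (?v @ ([(s, \<not> b), (s, b)] @ w)) (?v @ ([] @ w))"
    by (intro braid_eq.append braid_eq.refl)
  with Cons.IH show ?case
    by (auto simp: a intro: braid_eq.trans)
qed

lemma group_B4: "group B4"
proof (rule groupI)
  fix x y z assume "x \<in> carrier B4" "y \<in> carrier B4" "z \<in> carrier B4"
  show "x \<otimes>\<^bsub>B4\<^esub> y \<otimes>\<^bsub>B4\<^esub> z = x \<otimes>\<^bsub>B4\<^esub> (y \<otimes>\<^bsub>B4\<^esub> z)"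
    unfolding B4_def by simp (transfer, simp add: braid_eq.refl)
next
  fix x assume "x \<in> carrier B4"
  show "\<one>\<^bsub>B4\<^esub> \<otimes>\<^bsub>B4\<^esub> x = x"
    unfolding B4_def by simp (transfer, simp add: braid_eq.refl)
  have "\<exists>y. braid_mult y x = braid_one"
    by transfer (use braid_eq_inverse in blast)
  then show "\<exists>y\<in>carrier B4. y \<otimes>\<^bsub>B4\<^esub> x = \<one>\<^bsub>B4\<^esub>"
    by (simp add: B4_def)
qed (auto simp: B4_def)

definition SL3Z :: "(int^3^3) monoid" where
  "SL3Z = \<lparr>carrier = {A. det A = 1}, mult = (**), one = mat 1\<rparr>"

text \<open>Matrices act on column vectors \<open>(r, s, t)\<close>.\<close>

fun burau_matrix :: "gen4 \<Rightarrow> int^3^3" where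
  "burau_matrix S1 = vector [vector [1, 1, 0], vector [0, 1, 0], vector [0, 0, 1]]"
| "burau_matrix S2 = vector [vector [1, 0, 0], vector [-1, 1, 1], vector [0, 0, 1]]"
| "burau_matrix S3 = vector [vector [1, 0, 0], vector [0, 1, 0], vector [0, -1, 1]]"

fun burau_letter :: "gen4 \<times> bool \<Rightarrow> int^3^3" where
  "burau_letter (s, True) = burau_matrix s"
| "burau_letter (s, False) = matrix_inv (burau_matrix s)"

fun burau_word :: "word4 \<Rightarrow> int^3^3" where
  "burau_word [] = mat 1"
| "burau_word (a # w) = burau_letter a ** burau_word w"

lemma burau_word_append: "burau_word (u @ v) = burau_word u ** burau_word v"
  by (induction u) (auto simp: matrix_mul_assoc)

lemma mat3_mult:
  "(vector [vector [a, b, c], vector [d, e, f], vector [g, h, i]] :: int^3^3)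
     ** (vector [vector [a', b', c'], vector [d', e', f'], vector [g', h', i']] :: int^3^3)
   = vector [vector [a*a' + b*d' + c*g', a*b' + b*e' + c*h', a*c' + b*f' + c*i'],
             vector [d*a' + e*d' + f*g', d*b' + e*e' + f*h', d*c' + e*f' + f*i'],
             vector [g*a' + h*d' + i*g', g*b' + h*e' + i*h', g*c' + h*f' + i*i']]"
  by (simp add: vec_eq_iff forall_3 matrix_matrix_mult_def sum_3)

lemma mat3_one: "(mat 1 :: int^3^3) = vector [vector [1, 0, 0], vector [0, 1, 0], vector [0, 0, 1]]"
  by (simp add: vec_eq_iff forall_3 mat_def)

lemma invertible_burau_matrix: "invertible (burau_matrix s)"
  unfolding invertible_def
proof (cases s)
  case S1
  show "\<exists>A. burau_matrix s ** A = mat 1 \<and> A ** burau_matrix s = mat 1"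
    by (rule exI[of _ "vector [vector [1, -1, 0], vector [0, 1, 0], vector [0, 0, 1]]"])
      (simp add: S1 mat3_mult mat3_one)
next
  case S2
  show "\<exists>A. burau_matrix s ** A = mat 1 \<and> A ** burau_matrix s = mat 1"
    by (rule exI[of _ "vector [vector [1, 0, 0], vector [1, 1, -1], vector [0, 0, 1]]"])
      (simp add: S2 mat3_mult mat3_one)
next
  case S3
  show "\<exists>A. burau_matrix s ** A = mat 1 \<and> A ** burau_matrix s = mat 1"
    by (rule exI[of _ "vector [vector [1, 0, 0], vector [0, 1, 0], vector [0, 1, 1]]"])
      (simp add: S3 mat3_mult mat3_one)
qed

lemma burau_letter_inverse:
  "burau_letter (s, True) ** burau_letter (s, False) = mat 1"
  "burau_letter (s, False) ** burau_letter (s, True) = mat 1"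
proof -
  have "\<exists>A. burau_matrix s ** A = mat 1 \<and> A ** burau_matrix s = mat 1"
    using invertible_burau_matrix[of s] by (simp add: invertible_def)
  from someI_ex[OF this]
  show "burau_letter (s, True) ** burau_letter (s, False) = mat 1"
    "burau_letter (s, False) ** burau_letter (s, True) = mat 1"
    by (simp_all add: matrix_inv_def)
qed

lemma burau_word_braid_eq: "braid_eq u v \<Longrightarrow> burau_word u = burau_word v"
proof (induction rule: braid_eq.induct)
  case (cancel s b)
  then show ?case by (cases b) (simp_all add: burau_letter_inverse del: burau_letter.simps)
qed (simp_all add: burau_word_append mat3_mult mat3_one)

lift_definition burau :: "braid4 \<Rightarrow> int^3^3" is burau_word
  by (rule burau_word_braid_eq)

lemma burau_gen: "burau (braid_gen s) = burau_matrix s"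
  by transfer simp

lemma burau_mult: "burau (braid_mult g h) = burau g ** burau h"
  by transfer (rule burau_word_append)

lemma burau_one: "burau braid_one = mat 1"
  by transfer simp

lemma det_burau_letter: "det (burau_letter (s, b)) = 1"
proof -
  have t: "det (burau_letter (s, True)) = 1"
    by (cases s) (simp_all add: det_3)
  have "det (burau_letter (s, True) ** burau_letter (s, False)) = 1"
    by (simp only: burau_letter_inverse det_I)
  then have "det (burau_letter (s, False)) = 1"
    by (simp only: det_mul t mult_1)
  with t show ?thesis by (cases b) simp_all
qed

lemma burau_hom: "burau \<in> hom B4 SL3Z"
proof -
  have "det (burau_word w) = 1" for w
    by (induction w) (auto simp: det_mul det_burau_letter simp del: burau_letter.simps)
  then have "det (burau g) = 1" for g
    by transfer
  then show ?thesis
    by (simp add: hom_def B4_def SL3Z_def burau_mult)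
qed

text \<open>A point of the projective plane is a line through the origin.\<close>

definition proj_plane :: "('a::field^3) set set" where
  "proj_plane = {vec.span {v} | v. v \<noteq> 0}"

definition proj_point :: "'a::field \<Rightarrow> 'a \<Rightarrow> 'a \<Rightarrow> ('a^3) set" where
  "proj_point r s t = vec.span {vector [r, s, t]}"

text \<open>The topology on the real projective plane is the quotient topology of \<open>\<real>\<^sup>3 - {0}\<close>.\<close>

definition RP2_topology :: "(real^3) set topology" where
  "RP2_topology = topology (\<lambda>U. U \<subseteq> proj_plane \<and> open {v. v \<noteq> 0 \<and> vec.span {v} \<in> U})"

lemma openin_RP2_topology:
  "openin RP2_topology U \<longleftrightarrow> U \<subseteq> proj_plane \<and> open {v. v \<noteq> 0 \<and> vec.span {v} \<in> U}"
proof -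
  have "istopology (\<lambda>U::(real^3) set set. U \<subseteq> proj_plane \<and> open {v. v \<noteq> 0 \<and> vec.span {v} \<in> U})"
    unfolding istopology_def
  proof (intro conjI allI impI)
    fix S T :: "(real^3) set set"
    assume "S \<subseteq> proj_plane \<and> open {v. v \<noteq> 0 \<and> vec.span {v} \<in> S}"
      and "T \<subseteq> proj_plane \<and> open {v. v \<noteq> 0 \<and> vec.span {v} \<in> T}"
    moreover have "{v. v \<noteq> 0 \<and> vec.span {v} \<in> S \<inter> T} =
        {v. v \<noteq> 0 \<and> vec.span {v} \<in> S} \<inter> {v. v \<noteq> 0 \<and> vec.span {v} \<in> T}" by auto
    ultimately show "S \<inter> T \<subseteq> proj_plane" "open {v. v \<noteq> 0 \<and> vec.span {v} \<in> S \<inter> T}" by auto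
  next
    fix K :: "(real^3) set set set"
    assume K: "\<forall>S\<in>K. S \<subseteq> proj_plane \<and> open {v. v \<noteq> 0 \<and> vec.span {v} \<in> S}"
    then show "\<Union>K \<subseteq> proj_plane" by blast
    have "{v. v \<noteq> 0 \<and> vec.span {v} \<in> \<Union>K} = (\<Union>S\<in>K. {v. v \<noteq> 0 \<and> vec.span {v} \<in> S})" by auto
    with K show "open {v. v \<noteq> 0 \<and> vec.span {v} \<in> \<Union>K}" by auto
  qed
  then show ?thesis
    by (simp add: RP2_topology_def topology_inverse')
qed

lemma topspace_RP2_topology: "topspace RP2_topology = proj_plane"
proof -
  have "{v::real^3. v \<noteq> 0 \<and> vec.span {v} \<in> proj_plane} = - {0}"
    by (auto simp: proj_plane_def)
  then have "openin RP2_topology proj_plane"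
    by (simp add: openin_RP2_topology open_Compl)
  then show ?thesis
    by (meson openin_RP2_topology openin_subset openin_topspace subset_antisym)
qed

lemma quotient_map_RP2_topology:
  "quotient_map (top_of_set (- {0})) RP2_topology (\<lambda>v. vec.span {v})"
proof -
  have "open (- {0 :: real^3})" by (simp add: open_Compl)
  then have "openin (top_of_set (- {0 :: real^3})) {v \<in> - {0}. vec.span {v} \<in> U} \<longleftrightarrow>
      open {v. v \<noteq> 0 \<and> vec.span {v} \<in> U}" for U
    by (auto simp: openin_open_eq)
  then show ?thesis
    by (auto simp: quotient_map_def topspace_RP2_topology openin_RP2_topology proj_plane_def)
qed

definition QP2_embed :: "(rat^3) set \<Rightarrow> (real^3) set" where
  "QP2_embed L = vec.span ((\<lambda>v. \<chi> i. of_rat (v $ i)) ` L)"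

definition QP2_topology :: "(rat^3) set topology" where
  "QP2_topology = pullback_topology proj_plane QP2_embed RP2_topology"

lemma QP2_embed_span:
  "QP2_embed (vec.span {v}) = vec.span {\<chi> i. of_rat (v $ i)}"
proof -
  have "(\<lambda>v. \<chi> i. of_rat (v $ i)) ` vec.span {v} \<subseteq> vec.span {(\<chi> i. of_rat (v $ i)) :: real^3}"
  proof
    fix x :: "real^3" assume "x \<in> (\<lambda>v. \<chi> i. of_rat (v $ i)) ` vec.span {v}"
    then obtain c where "x = (\<chi> i. of_rat ((c *s v) $ i))"
      by (auto simp: vec.span_singleton)
    then have "x = of_rat c *s (\<chi> i. of_rat (v $ i))"
      by (simp add: vec_eq_iff of_rat_mult)
    then show "x \<in> vec.span {(\<chi> i. of_rat (v $ i)) :: real^3}"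
      by (auto simp: vec.span_singleton)
  qed
  moreover have "(\<chi> i. of_rat (v $ i)) \<in> (\<lambda>v. (\<chi> i. of_rat (v $ i)) :: real^3) ` vec.span {v}"
    by (auto intro: vec.span_base)
  ultimately show ?thesis
    unfolding QP2_embed_def
    by (intro subset_antisym vec.span_minimal vec.span_mono) (auto simp: vec.subspace_span)
qed

lemma topspace_QP2_topology: "topspace QP2_topology = proj_plane"
proof -
  have "QP2_embed L \<in> proj_plane" if L: "L \<in> proj_plane" for L
  proof -
    obtain v where v: "L = vec.span {v}" "v \<noteq> 0"
      using L by (auto simp: proj_plane_def)
    then have "((\<chi> i. of_rat (v $ i)) :: real^3) \<noteq> 0"
      by (simp add: vec_eq_iff)
    with v(1) show ?thesis by (auto simp: proj_plane_def QP2_embed_span)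
  qed
  then show ?thesis
    by (auto simp: QP2_topology_def topspace_pullback_topology topspace_RP2_topology)
qed

definition burau_action :: "braid4 \<Rightarrow> (rat^3) set \<Rightarrow> (rat^3) set" where
  "burau_action g = (\<lambda>L\<in>proj_plane. (\<lambda>v. map_matrix of_int (burau g) *v v) ` L)"

lemma burau_image_span:
  "(\<lambda>v. (A :: rat^3^3) *v v) ` vec.span {v} = vec.span {A *v v}"
  by (force simp: vec.span_singleton vector_scalar_commute)

lemma map_matrix_of_int_mult:
  "(map_matrix of_int (A ** B) :: rat^3^3) = map_matrix of_int A ** map_matrix of_int B"
  by (simp add: vec_eq_iff matrix_matrix_mult_def)

lemma map_matrix_of_int_one: "(map_matrix of_int (mat 1) :: rat^3^3) = mat 1"
  by (simp add: vec_eq_iff mat_def)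

lemma burau_action_group_action: "group_action B4 proj_plane burau_action"
proof -
  let ?M = "\<lambda>g. map_matrix of_int (burau g) :: rat^3^3"
  interpret B4: group B4 by (rule group_B4)
  have mult: "?M (g \<otimes>\<^bsub>B4\<^esub> h) = ?M g ** ?M h" for g h
    by (simp add: B4_def burau_mult map_matrix_of_int_mult)
  have one: "?M \<one>\<^bsub>B4\<^esub> = mat 1"
    by (simp add: B4_def burau_one map_matrix_of_int_one)
  have car: "g \<in> carrier B4" for g by (simp add: B4_def)
  have inv: "?M (inv\<^bsub>B4\<^esub> g) ** ?M g = mat 1" "?M g ** ?M (inv\<^bsub>B4\<^esub> g) = mat 1" for g
    by (simp_all only: mult[symmetric] B4.l_inv[OF car] B4.r_inv[OF car] one)
  have maps: "burau_action g L \<in> proj_plane" if L: "L \<in> proj_plane" for g L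
  proof -
    obtain v where v: "L = vec.span {v}" "v \<noteq> 0"
      using L by (auto simp: proj_plane_def)
    have "?M g *v v \<noteq> 0"
      using inv(1)[of g] v(2)
      by (metis matrix_vector_mul_assoc matrix_vector_mul_lid matrix_vector_mult_0_right)
    then show ?thesis
      using L v(1) by (auto simp: burau_action_def burau_image_span proj_plane_def)
  qed
  have comp: "burau_action (g \<otimes>\<^bsub>B4\<^esub> h) L = burau_action g (burau_action h L)"
    if L: "L \<in> proj_plane" for g h L
    using L maps[OF L, of h]
    by (simp add: burau_action_def mult image_image matrix_vector_mul_assoc)
  have id: "burau_action \<one>\<^bsub>B4\<^esub> L = L" if "L \<in> proj_plane" for L
    using that by (simp add: burau_action_def one)
  have bij: "burau_action g \<in> Bij proj_plane" for g
    unfolding Bij_def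
  proof (intro IntI CollectI)
    show "burau_action g \<in> extensional proj_plane" by (simp add: burau_action_def)
    show "bij_betw (burau_action g) proj_plane proj_plane"
      by (rule bij_betw_byWitness[where f' = "burau_action (inv\<^bsub>B4\<^esub> g)"])
        (auto simp: maps comp[symmetric] B4.l_inv[OF car] B4.r_inv[OF car] id)
  qed
  have "burau_action (g \<otimes>\<^bsub>B4\<^esub> h) = compose proj_plane (burau_action g) (burau_action h)" for g h
  proof (rule extensionalityI[of _ proj_plane])
    fix L :: "(rat^3) set" assume "L \<in> proj_plane"
    then show "burau_action (g \<otimes>\<^bsub>B4\<^esub> h) L = compose proj_plane (burau_action g) (burau_action h) L"
      by (simp add: comp compose_eq)
  qed (simp_all add: burau_action_def)
  then have "burau_action \<in> hom B4 (BijGroup proj_plane)"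
    by (simp add: hom_def BijGroup_def bij)
  then show ?thesis
    by (simp add: group_action_def group_hom_def group_hom_axioms_def group_B4 group_BijGroup)
qed

lemma burau_action_gen:
  assumes "(r, s, t) \<noteq> (0, 0, 0)"
  shows "burau_action (braid_gen S1) (proj_point r s t) = proj_point (r + s) s t"
    and "burau_action (braid_gen S2) (proj_point r s t) = proj_point r (s + t - r) t"
    and "burau_action (braid_gen S3) (proj_point r s t) = proj_point r s (t - s)"
proof -
  have "(vector [r, s, t] :: rat^3) \<noteq> 0"
    using assms by (auto simp: vec_eq_iff forall_3)
  then have "proj_point r s t \<in> proj_plane"
    by (auto simp: proj_plane_def proj_point_def)
  moreover have
    "map_matrix of_int (burau_matrix S1) *v vector [r, s, t] = (vector [r + s, s, t] :: rat^3)"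
    "map_matrix of_int (burau_matrix S2) *v vector [r, s, t] = (vector [r, s + t - r, t] :: rat^3)"
    "map_matrix of_int (burau_matrix S3) *v vector [r, s, t] = (vector [r, s, t - s] :: rat^3)"
    by (simp_all add: vec_eq_iff forall_3 matrix_vector_mult_def sum_3)
  ultimately show
    "burau_action (braid_gen S1) (proj_point r s t) = proj_point (r + s) s t"
    "burau_action (braid_gen S2) (proj_point r s t) = proj_point r (s + t - r) t"
    "burau_action (braid_gen S3) (proj_point r s t) = proj_point r s (t - s)"
    by (simp_all add: burau_action_def burau_gen burau_image_span proj_point_def del: burau_matrix.simps)
qed

end

theory Submission
  imports Defs
begin

text \<open>In the coordinates \<open>(r, s, d)\<close> with \<open>d = t - r\<close>, the generators \<open>\<sigma>\<^sub>2\<close> and \<open>\<sigma>\<^sub>3\<close> fix \<open>r\<close> and act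
  on \<open>(s, d)\<close> as elementary generators of \<open>SL\<^sub>2(\<int>)\<close>, while \<open>\<sigma>\<^sub>1 \<sigma>\<^sub>3\<^sup>-\<^sup>1\<close> adds \<open>s\<close> to \<open>r\<close>.
  A point other than \<open>[1:0:1]\<close> can be scaled to \<open>(\<rho>, s, d)\<close> with coprime integers \<open>s\<close> and \<open>d\<close>. The
  Euclidean algorithm moves it to \<open>(\<rho>, 1, 0)\<close>, then to \<open>(\<rho> + k, 1, 0)\<close>, and hence to every
  \<open>(\<rho> + k, s', d')\<close> with \<open>k\<close> an integer and \<open>s', d'\<close> coprime. These points are dense: for an integer
  vector \<open>(R, a, b)\<close> and \<open>a' = n a + 1\<close>, the vectors
  \<open>(\<rho> + n R a', a'\<^sup>2, n b a' + 1) / (n a')\<close> converge to \<open>(R, a, b)\<close>.\<close>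

section \<open>Scaling and clearing denominators\<close>

lemma span_singleton_scale:
  fixes v :: "'a::field^'n"
  assumes "c \<noteq> 0"
  shows "vec.span {c *s v} = vec.span {v}"
proof -
  have "v = inverse c *s (c *s v)"
    using assms by (simp add: vector_smult_assoc)
  then have "v \<in> vec.span {c *s v}"
    by (metis vec.span_base vec.span_scale singletonI)
  moreover have "c *s v \<in> vec.span {v}"
    by (simp add: vec.span_base vec.span_scale)
  ultimately show ?thesis
    by (intro subset_antisym vec.span_minimal) (auto simp: vec.subspace_span)
qed

lemma common_denominator:
  fixes v :: "rat^'n"
  obtains q :: int and w :: "int^'n"
  where "q > 0" "v = (1 / of_int q) *s (\<chi> i. of_int (w $ i))"
proof
  define den where "den i = snd (quotient_of (v $ i))" for i
  define num where "num i = fst (quotient_of (v $ i))" for i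
  \<comment> \<open>The product of all denominators; removing the factor \<open>den i\<close> leaves
    the cofactor that appears in \<open>w\<close>.\<close>
  define q where "q = prod den UNIV"
  define w :: "int^'n" where "w = (\<chi> i. num i * prod den (UNIV - {i}))"
  have pos: "den i > 0" for i
    by (simp add: den_def quotient_of_denom_pos')
  then show "q > 0"
    by (simp add: q_def prod_pos)
  have v: "v $ i = of_int (num i) / of_int (den i)" for i
    by (simp add: num_def den_def quotient_of_div)
  have "v $ i = 1 / of_int q * of_int (w $ i)" for i
  proof -
    have "q = den i * prod den (UNIV - {i})"
      by (simp add: q_def prod.remove)
    moreover have "prod den (UNIV - {i}) > 0"
      using pos by (simp add: prod_pos)
    ultimately show ?thesis
      using pos[of i] by (simp add: v w_def less_imp_neq[symmetric] del: of_int_prod)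
  qed
  then show "v = (1 / of_int q) *s (\<chi> i. of_int (w $ i))"
    by (simp add: vec_eq_iff)
qed

section \<open>The Euclidean algorithm on coprime pairs\<close>

text \<open>The two shears generate SL(2,Z), which is transitive on coprime pairs. Phrasing this
  through an invariant predicate lets \<open>P\<close> express membership in an orbit of vectors of
  size three.\<close>

lemma coprime_pair_invariant:
  fixes P :: "int \<Rightarrow> int \<Rightarrow> bool"
  assumes shear: "\<And>s d. P (s + d) d \<longleftrightarrow> P s d" "\<And>s d. P s (d - s) \<longleftrightarrow> P s d"
    and "coprime s d"
  shows "P s d \<longleftrightarrow> P 1 0"
proof -
  \<comment> \<open>Three shears compose to a quarter turn: (s, d), (s + d, d), (s + d, -s), (d,
    -s).\<close>
  have rot: "P d (- s) \<longleftrightarrow> P s d" for s d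
    using shear(1)[of s d] shear(2)[of "s + d" d] shear(1)[of "s + d" "- s"] by simp
  have mult: "P (s + k * d) d \<longleftrightarrow> P s d" for s d k
  proof (induction k rule: int_induct[where k = 0])
    case (step1 i)
    then show ?case
      using shear(1)[of "s + i * d" d] by (simp add: algebra_simps)
  next
    case (step2 i)
    then show ?case
      using shear(1)[of "s + (i - 1) * d" d] by (simp add: algebra_simps)
  qed simp
  show ?thesis
    using \<open>coprime s d\<close>
  proof (induction "nat \<bar>d\<bar>" arbitrary: s d rule: less_induct)
    case less
    show ?case
    proof (cases "d = 0")
      case True
      then have "s = 1 \<or> s = - 1"
        using less.prems by auto
      \<comment> \<open>Two quarter turns carry (1, 0) to (-1, 0).\<close>
      then show ?thesis
        using True rot[of 1 0] rot[of 0 "- 1"] by auto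
    next
      case False
      \<comment> \<open>One Euclidean step: reduce \<open>s\<close> modulo \<open>d\<close>, then
        turn, so that the smaller remainder becomes the second entry up to sign.\<close>
      have "P s d \<longleftrightarrow> P (s mod d) d"
        using mult[of "s mod d" "s div d" d] by simp
      also have "\<dots> \<longleftrightarrow> P d (- (s mod d))"
        by (rule rot[symmetric])
      also have "\<dots> \<longleftrightarrow> P 1 0"
      proof (rule less.hyps)
        show "nat \<bar>- (s mod d)\<bar> < nat \<bar>d\<bar>"
          using False by (simp add: abs_mod_less)
        show "coprime d (- (s mod d))"
          using less.prems False by (simp add: coprime_commute)
      qed
      finally show ?thesis .
    qed
  qed
qed

section \<open>The action on rational vectors\<close>

definition burau_rat :: "braid4 \<Rightarrow> rat^3^3" where
  "burau_rat g = map_matrix of_int (burau g)"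

lemma burau_rat_mult: "burau_rat (braid_mult g h) = burau_rat g ** burau_rat h"
  by (simp add: burau_rat_def burau_mult map_matrix_of_int_mult)

lemma burau_rat_one: "burau_rat braid_one = mat 1"
  by (simp add: burau_rat_def burau_one map_matrix_of_int_one)

lemma burau_rat_inverse: "\<exists>h. burau_rat h ** burau_rat g = mat 1"
proof -
  have "\<exists>h. braid_mult h g = braid_one"
    using group.l_inv_ex[OF group_B4, of g] by (auto simp: B4_def)
  then show ?thesis
    by (metis burau_rat_mult burau_rat_one)
qed

lemma span_singleton_in_proj_plane: "v \<noteq> 0 \<Longrightarrow> vec.span {v} \<in> proj_plane"
  by (auto simp: proj_plane_def)

lemma burau_action_span:
  assumes "v \<noteq> 0"
  shows "burau_action g (vec.span {v}) = vec.span {burau_rat g *v v}"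
  using span_singleton_in_proj_plane[OF assms]
  by (simp add: burau_action_def burau_rat_def burau_image_span)

text \<open>Each generator fixes this vector itself, not merely its line; hence so do inverses and
  words. The calculation is done over the integers and cast entrywise.\<close>

lemma burau_rat_fixed: "burau_rat g *v vector [1, 0, 1] = vector [1, 0, 1]"
proof -
  have gen: "burau_letter (s, True) *v vector [1, 0, 1] = vector [1, 0, 1]" for s
    by (cases s) (simp_all add: vec_eq_iff forall_3 matrix_vector_mult_def sum_3)
  have "burau_letter (s, False) *v vector [1, 0, 1] = vector [1, 0, 1]" for s
    using gen[of s] burau_letter_inverse(2)[of s]
    by (metis matrix_vector_mul_assoc matrix_vector_mul_lid)
  with gen have letter: "burau_letter (s, b) *v vector [1, 0, 1] = vector [1, 0, 1]" for s b
    by (cases b) simp_all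
  have "burau_word w *v vector [1, 0, 1] = vector [1, 0, 1]" for w
    by (induction w)
      (auto simp: letter matrix_vector_mul_assoc[symmetric] simp del: burau_letter.simps)
  then have "burau g *v vector [1, 0, 1] = vector [1, 0, 1]"
    by transfer
  then have "of_int ((burau g *v vector [1, 0, 1]) $ i) = (of_int (vector [1, 0, 1] $ i) :: rat)" for i
    by simp
  then show ?thesis
    by (simp add: burau_rat_def vec_eq_iff forall_3 matrix_vector_mult_def sum_3)
qed

text \<open>The orbit relation is kept on vectors, so that generators act by explicit formulas;
  spans are taken only when passing to orbits of lines.\<close>

definition burau_equiv :: "rat^3 \<Rightarrow> rat^3 \<Rightarrow> bool" where
  "burau_equiv u v \<longleftrightarrow> (\<exists>g. burau_rat g *v u = v)"

lemma equivp_burau_equiv: "equivp burau_equiv"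
proof (intro equivpI reflpI sympI transpI)
  show "burau_equiv u u" for u
    unfolding burau_equiv_def by (metis burau_rat_one matrix_vector_mul_lid)
  show "burau_equiv v u" if "burau_equiv u v" for u v
    using that unfolding burau_equiv_def
    by (metis burau_rat_inverse matrix_vector_mul_assoc matrix_vector_mul_lid)
  show "burau_equiv u w" if "burau_equiv u v" "burau_equiv v w" for u v w
    using that unfolding burau_equiv_def
    by (metis burau_rat_mult matrix_vector_mul_assoc)
qed

section \<open>Transitivity in the shifted coordinates\<close>

text \<open>The fixed line becomes \<open>s = d = 0\<close>. The type is generic to serve integer
  targets, rational orbit vectors and real limits.\<close>

definition shifted_vector :: "'a::ring_1 \<Rightarrow> 'a \<Rightarrow> 'a \<Rightarrow> 'a^3" where
  "shifted_vector r s d = vector [r, s, r + d]"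

lemma shifted_vector_cases:
  fixes v :: "'a::ring_1^3"
  obtains r s d where "v = shifted_vector r s d"
proof
  show "v = shifted_vector (v $ 1) (v $ 2) (v $ 3 - v $ 1)"
    by (simp add: shifted_vector_def vec_eq_iff forall_3)
qed

lemma scale_shifted_vector: "c *s shifted_vector r s d = shifted_vector (c * r) (c * s) (c * d)"
  by (simp add: shifted_vector_def vec_eq_iff forall_3 algebra_simps)

lemma burau_equiv_gen:
  "burau_equiv (shifted_vector r s d) (shifted_vector (r + s) s (d - s))"
  "burau_equiv (shifted_vector r s d) (shifted_vector r (s + d) d)"
  "burau_equiv (shifted_vector r s d) (shifted_vector r s (d - s))"
proof -
  have "burau_rat (braid_gen S1) *v shifted_vector r s d = shifted_vector (r + s) s (d - s)"
    "burau_rat (braid_gen S2) *v shifted_vector r s d = shifted_vector r (s + d) d"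
    "burau_rat (braid_gen S3) *v shifted_vector r s d = shifted_vector r s (d - s)"
    by (simp_all add: burau_rat_def burau_gen shifted_vector_def vec_eq_iff forall_3
        matrix_vector_mult_def sum_3)
  then show "burau_equiv (shifted_vector r s d) (shifted_vector (r + s) s (d - s))"
    "burau_equiv (shifted_vector r s d) (shifted_vector r (s + d) d)"
    "burau_equiv (shifted_vector r s d) (shifted_vector r s (d - s))"
    unfolding burau_equiv_def by blast+
qed

text \<open>Both pairs are joined to (1, 0); there the second coordinate is 1, so changes of the
  first coordinate come in unit steps.\<close>

lemma burau_equiv_coprime:
  fixes s d s' d' k :: int
  assumes "coprime s d" "coprime s' d'"
  shows "burau_equiv (shifted_vector r (of_int s) (of_int d))
    (shifted_vector (r + of_int k) (of_int s') (of_int d'))"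
proof -
  note sym = equivp_symp[OF equivp_burau_equiv] and trans = equivp_transp[OF equivp_burau_equiv]
  have base: "burau_equiv (shifted_vector r 1 0) (shifted_vector r (of_int s) (of_int d))"
    if "coprime s d" for r and s d :: int
  proof -
    let ?P = "\<lambda>s d. burau_equiv (shifted_vector r 1 0) (shifted_vector r (of_int s) (of_int d))"
    have "?P s d \<longleftrightarrow> ?P 1 0"
    proof (rule coprime_pair_invariant[OF _ _ that])
      show "?P (s + d) d \<longleftrightarrow> ?P s d" for s d
        using burau_equiv_gen(2)[of r "of_int s" "of_int d"]
        unfolding of_int_add by (meson sym trans)
      show "?P s (d - s) \<longleftrightarrow> ?P s d" for s d
        using burau_equiv_gen(3)[of r "of_int s" "of_int d"]
        unfolding of_int_diff by (meson sym trans)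
    qed
    then show ?thesis
      by (simp add: equivp_reflp[OF equivp_burau_equiv])
  qed
  \<comment> \<open>\<sigma>1 sends (r, 1, 0) to (r + 1, 1, -1), and undoing \<sigma>3 restores the
    last entry to 0.\<close>
  have up: "burau_equiv (shifted_vector r 1 0) (shifted_vector (r + 1) 1 0)" for r
    using burau_equiv_gen(1)[of r 1 0] burau_equiv_gen(3)[of "r + 1" 1 0]
    by (meson sym trans)
  have "burau_equiv (shifted_vector r 1 0) (shifted_vector (r + of_int k) 1 0)"
  proof (induction k rule: int_induct[where k = 0])
    case base
    then show ?case by (simp add: equivp_reflp[OF equivp_burau_equiv])
  next
    case (step1 i)
    show ?case
      using trans[OF step1.IH up[of "r + of_int i"]] by (simp add: add.assoc)
  next
    case (step2 i)
    have "r + of_int (i - 1) + 1 = r + of_int i"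
      by simp
    then show ?case
      using step2.IH sym[OF up[of "r + of_int (i - 1)"]] by (metis trans)
  qed
  from trans[OF this base[OF assms(2)]] show ?thesis
    by (rule trans[OF sym[OF base[OF assms(1)]]])
qed

text \<open>After clearing denominators, divide by the gcd. Only \<open>s\<close> and
  \<open>d\<close> are normalised; the first coordinate may stay an arbitrary rational.\<close>

lemma primitive_scaling:
  fixes s d :: rat
  assumes "s \<noteq> 0 \<or> d \<noteq> 0"
  obtains c :: rat and s' d' :: int
  where "c \<noteq> 0" "s = c * of_int s'" "d = c * of_int d'" "coprime s' d'"
proof -
  obtain q :: int and w :: "int^2"
    where q: "q > 0" and w: "vector [s, d] = (1 / of_int q :: rat) *s (\<chi> i. of_int (w $ i))"
    by (rule common_denominator)
  define g where "g = gcd (w $ 1) (w $ 2)"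
  have sd: "s = of_int (w $ 1) / of_int q" "d = of_int (w $ 2) / of_int q"
    using w by (simp_all add: vec_eq_iff forall_2)
  then have nz: "w $ 1 \<noteq> 0 \<or> w $ 2 \<noteq> 0"
    using assms by auto
  then obtain s' d' where "w $ 1 = s' * g" "w $ 2 = d' * g" "coprime s' d'"
    unfolding g_def by (metis gcd_coprime_exists gcd_eq_0_iff)
  moreover have "g \<noteq> 0"
    using nz by (simp add: g_def)
  ultimately show thesis
    using q sd by (intro that[of "of_int g / of_int q" s' d']) auto
qed

section \<open>Approximating integer vectors by orbit vectors\<close>

lemma tendsto_primitive_approximation:
  fixes R a b :: int and \<rho> :: real
  shows "(\<lambda>n. shifted_vector (\<rho> / (real n * (real n * a + 1)) + R) (a + 1 / real n)
      (b + 1 / (real n * (real n * a + 1)))) \<longlonglongrightarrow> shifted_vector (of_int R) (of_int a) (of_int b)"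
proof -
  have inv: "(\<lambda>n. 1 / real n) \<longlonglongrightarrow> 0"
    by (rule lim_1_over_n)
  have "\<forall>\<^sub>F n in sequentially. norm (1 / (real n * (real n * a + 1))) \<le> 1 / real n"
    using eventually_ge_at_top[of 2]
  proof eventually_elim
    case (elim n)
    \<comment> \<open>A zero would make \<open>n\<close> divide 1, which \<open>n \<ge> 2\<close>
      excludes. A nonzero integer has absolute value at least 1, whence the bound by
      \<open>1 / n\<close>.\<close>
    have "int n * a + 1 \<noteq> 0"
    proof
      assume "int n * a + 1 = 0"
      then have "int n * (- a) = 1" by simp
      then show False
        using elim zmult_eq_1_iff[of "int n" "- a"] by auto
    qed
    then have "1 \<le> \<bar>int n * a + 1\<bar>" by linarith
    then have "real_of_int 1 \<le> real_of_int \<bar>int n * a + 1\<bar>"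
      by (simp only: of_int_le_iff)
    then have "1 \<le> \<bar>real n * a + 1\<bar>"
      by simp
    then have "real n * 1 \<le> real n * \<bar>real n * a + 1\<bar>"
      by (intro mult_left_mono) auto
    then show ?case
      using elim by (simp add: abs_mult frac_le)
  qed
  then have prod: "(\<lambda>n. 1 / (real n * (real n * a + 1))) \<longlonglongrightarrow> 0"
    by (rule Lim_null_comparison[OF _ inv])
  have r: "(\<lambda>n. \<rho> / (real n * (real n * a + 1)) + R) \<longlonglongrightarrow> R"
    using tendsto_add[OF tendsto_mult_left[OF prod, of \<rho>] tendsto_const[of "of_int R"]] by simp
  have s: "(\<lambda>n. a + 1 / real n) \<longlonglongrightarrow> a"
    using tendsto_add[OF tendsto_const[of "of_int a"] inv] by simp
  have d: "(\<lambda>n. b + 1 / (real n * (real n * a + 1))) \<longlonglongrightarrow> b"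
    using tendsto_add[OF tendsto_const[of "of_int b"] prod] by simp
  show ?thesis
    unfolding shifted_vector_def
  proof (rule vec_tendstoI)
    fix i :: 3
    consider "i = 1" | "i = 2" | "i = 3"
      using exhaust_3 by blast
    then show "(\<lambda>n. vector [\<rho> / (real n * (real n * a + 1)) + R, a + 1 / real n,
        \<rho> / (real n * (real n * a + 1)) + R + (b + 1 / (real n * (real n * a + 1)))] $ i)
        \<longlonglongrightarrow> vector [of_int R, of_int a, of_int R + of_int b] $ i"
      by cases (use r s tendsto_add[OF r d] in simp_all)
  qed
qed

text \<open>Multiplying \<open>y\<close> by \<open>n * a'\<close> with \<open>a' = n * a + 1\<close>
  gives integer second and third entries and a first entry differing from \<rho> by an integer.
  Using \<open>a'\<close> in place of \<open>a\<close> keeps the scale factor nonzero even for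
  \<open>a = 0\<close>.\<close>

lemma burau_equiv_approximation:
  fixes s d R a b :: int and \<rho> :: rat
  assumes "coprime s d" "n \<ge> 2"
  defines "y \<equiv> shifted_vector (\<rho> / (of_nat n * (of_nat n * of_int a + 1)) + of_int R)
    (of_int a + 1 / of_nat n) (of_int b + 1 / (of_nat n * (of_nat n * of_int a + 1)))"
  obtains z where "burau_equiv (shifted_vector \<rho> (of_int s) (of_int d)) z" "vec.span {z} = vec.span {y}"
proof
  define a' where "a' = int n * a + 1"
  let ?z = "shifted_vector (\<rho> + of_int (int n * R * a')) (of_int (a'\<^sup>2)) (of_int (int n * b * a' + 1))"
  \<comment> \<open>A common divisor of \<open>a'\<close> and \<open>n * b * a' + 1\<close> divides
    1.\<close>
  have "coprime a' (int n * b * a' + 1)"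
    by (rule coprimeI) (simp add: dvd_add_right_iff)
  then have "coprime (a'\<^sup>2) (int n * b * a' + 1)"
    by simp
  then show "burau_equiv (shifted_vector \<rho> (of_int s) (of_int d)) ?z"
    by (rule burau_equiv_coprime[OF assms(1)])
  have "a' \<noteq> 0"
  proof
    assume "a' = 0"
    then have "int n * (- a) = 1" by (simp add: a'_def)
    then show False
      using assms(2) zmult_eq_1_iff[of "int n" "- a"] by auto
  qed
  then have nz: "of_nat n * of_int a' \<noteq> (0::rat)"
    using assms(2) by simp
  have a': "of_nat n * of_int a + 1 = (of_int a' :: rat)"
    by (simp add: a'_def)
  have "of_int a + 1 / of_nat n = (of_int a' / of_nat n :: rat)"
    using assms(2) by (simp add: a'_def field_simps)
  then have "(of_nat n * of_int a') *s y = ?z"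
    unfolding y_def a' scale_shifted_vector
    using nz by (simp add: distrib_left power2_eq_square mult.assoc mult.commute
        mult.left_commute)
  then show "vec.span {?z} = vec.span {y}"
    using span_singleton_scale[OF nz, of y] by simp
qed

section \<open>Density of the orbits\<close>

text \<open>Open sets of lines pull back to open sets of nonzero real vectors, so convergence of
  representatives is enough.\<close>

lemma closure_of_burau_orbit:
  assumes "coprime s d"
    and X: "\<And>z. z \<noteq> 0 \<Longrightarrow> burau_equiv (shifted_vector \<rho> (of_int s) (of_int d)) z \<Longrightarrow> vec.span {z} \<in> X"
  shows "QP2_topology closure_of X = topspace QP2_topology"
proof (intro subset_antisym closure_of_subset_topspace subsetI)
  fix L assume L: "L \<in> topspace QP2_topology"
  show "L \<in> QP2_topology closure_of X"
    unfolding in_closure_of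
  proof (intro conjI L allI impI)
    fix T assume T: "L \<in> T \<and> openin QP2_topology T"
    then obtain U where U: "openin RP2_topology U" "T = QP2_embed -` U \<inter> proj_plane"
      unfolding QP2_topology_def openin_pullback_topology by blast
    define V where "V = {v. v \<noteq> 0 \<and> vec.span {v} \<in> U}"
    have "open V"
      using U(1) by (simp add: V_def openin_RP2_topology)
    obtain v where v: "L = vec.span {v}" "v \<noteq> 0"
      using L by (auto simp: topspace_QP2_topology proj_plane_def)
    \<comment> \<open>An integer representative of \<open>L\<close> is chosen, since the
      approximating sequence is built for integer targets.\<close>
    obtain q :: int and w :: "int^3"
      where q: "q > 0" and vw: "v = (1 / of_int q) *s (\<chi> i. of_int (w $ i))"
      by (rule common_denominator)
    obtain R a b where w: "w = shifted_vector R a b"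
      by (rule shifted_vector_cases)
    have of_int_w: "(\<chi> i. of_int (w $ i)) = (shifted_vector (of_int R) (of_int a) (of_int b) :: rat^3)"
      by (simp add: w shifted_vector_def vec_eq_iff forall_3)
    then have "L = vec.span {shifted_vector (of_int R) (of_int a) (of_int b)}"
      using v(1) vw span_singleton_scale[of "1 / of_int q :: rat"] q by simp
    moreover have real: "(\<chi> i. of_rat (shifted_vector x y z $ i)) =
        (shifted_vector (of_rat x) (of_rat y) (of_rat z) :: real^3)" for x y z
      by (simp add: shifted_vector_def vec_eq_iff forall_3 of_rat_add)
    ultimately have "vec.span {shifted_vector (of_int R) (of_int a) (of_int b)} \<in> U"
      using T U(2) by (simp add: QP2_embed_span)
    moreover have "shifted_vector (of_int R) (of_int a) (of_int b) \<noteq> (0 :: real^3)"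
      using v(2) vw by (auto simp: of_int_w vec_eq_iff shifted_vector_def forall_3)
    ultimately have "shifted_vector (of_int R) (of_int a) (of_int b) \<in> V"
      by (simp add: V_def)
    then have "\<forall>\<^sub>F n in sequentially. shifted_vector (of_rat \<rho> / (real n * (real n * a + 1)) + R)
        (a + 1 / real n) (b + 1 / (real n * (real n * a + 1))) \<in> V"
      using topological_tendstoD[OF tendsto_primitive_approximation \<open>open V\<close>] by blast
    then have "\<forall>\<^sub>F n in sequentially. n \<ge> 2 \<and>
        shifted_vector (of_rat \<rho> / (real n * (real n * a + 1)) + R)
          (a + 1 / real n) (b + 1 / (real n * (real n * a + 1))) \<in> V"
      by (intro eventually_conj eventually_ge_at_top)
    then obtain n where n: "n \<ge> 2"
      and nV: "shifted_vector (of_rat \<rho> / (real n * (real n * a + 1)) + R)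
        (a + 1 / real n) (b + 1 / (real n * (real n * a + 1))) \<in> V"
      using eventually_happens trivial_limit_sequentially by blast
    define y where "y = shifted_vector (\<rho> / (of_nat n * (of_nat n * of_int a + 1)) + of_int R)
      (of_int a + 1 / of_nat n) (of_int b + 1 / (of_nat n * (of_nat n * of_int a + 1)))"
    have y_V: "(\<chi> i. of_rat (y $ i)) \<in> V"
      using nV by (simp add: y_def real of_rat_add of_rat_divide of_rat_mult)
    then have "y \<noteq> 0"
      by (auto simp: V_def vec_eq_iff)
    obtain z where z: "burau_equiv (shifted_vector \<rho> (of_int s) (of_int d)) z"
      "vec.span {z} = vec.span {y}"
      by (rule burau_equiv_approximation[OF assms(1) n, of \<rho> a R b, folded y_def])
    \<comment> \<open>The span of \<open>z\<close> contains the nonzero vector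
      \<open>y\<close>.\<close>
    have "z \<noteq> 0"
      using z(2) \<open>y \<noteq> 0\<close> vec.span_base[of y "{y}"] by auto
    then have "vec.span {y} \<in> X"
      using X[OF _ z(1)] unfolding z(2) by blast
    moreover have "vec.span {y} \<in> T"
      using y_V \<open>y \<noteq> 0\<close> unfolding U(2) V_def
      by (auto simp: QP2_embed_span span_singleton_in_proj_plane)
    ultimately show "\<exists>y. y \<in> X \<and> y \<in> T"
      by blast
  qed
qed

theorem proposition3p1:
  shows "{proj_point 1 0 1} \<in> orbits B4 proj_plane burau_action \<and>
    (\<forall>X \<in> orbits B4 proj_plane burau_action.
       X \<noteq> {proj_point 1 0 1} \<longrightarrow> QP2_topology closure_of X = topspace QP2_topology)"
proof -
  have orbit_span: "orbit B4 burau_action (vec.span {v}) = {vec.span {z} | z. burau_equiv v z}"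
    if "v \<noteq> 0" for v
    using that by (auto simp: orbit_def B4_def burau_action_span burau_equiv_def)
  have e_nz: "vector [1, 0, 1] \<noteq> (0 :: rat^3)"
    by (simp add: vec_eq_iff forall_3)
  have e_orbit: "orbit B4 burau_action (proj_point 1 0 1) = {proj_point 1 0 1}"
    unfolding proj_point_def orbit_span[OF e_nz] by (auto simp: burau_equiv_def burau_rat_fixed)
  have e_plane: "(proj_point 1 0 1 :: (rat^3) set) \<in> proj_plane"
    unfolding proj_point_def by (rule span_singleton_in_proj_plane[OF e_nz])
  show ?thesis
  proof (intro conjI ballI impI)
    show "{proj_point 1 0 1} \<in> orbits B4 proj_plane burau_action"
      using e_orbit e_plane unfolding orbits_def by blast
  next
    fix X assume "X \<in> orbits B4 proj_plane burau_action" and X_ne: "X \<noteq> {proj_point 1 0 1}"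
    then obtain v where v: "v \<noteq> 0" and X: "X = orbit B4 burau_action (vec.span {v})"
      by (auto simp: orbits_def proj_plane_def)
    obtain r s d where rsd: "v = shifted_vector r s d"
      by (rule shifted_vector_cases)
    \<comment> \<open>Otherwise \<open>v\<close> spans the fixed line and \<open>X\<close> is the
      excluded singleton.\<close>
    have "s \<noteq> 0 \<or> d \<noteq> 0"
    proof (rule ccontr)
      assume "\<not> (s \<noteq> 0 \<or> d \<noteq> 0)"
      then have "v = r *s vector [1, 0, 1]"
        by (simp add: rsd shifted_vector_def vec_eq_iff forall_3)
      then have "vec.span {v} = proj_point 1 0 1"
        using v span_singleton_scale[of r] by (auto simp: proj_point_def)
      then show False
        using X X_ne e_orbit by simp
    qed
    then obtain c s' d' where c: "c \<noteq> 0" "s = c * of_int s'" "d = c * of_int d'" "coprime s' d'"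
      by (rule primitive_scaling)
    \<comment> \<open>Dividing \<open>v\<close> by \<open>c\<close> keeps its line and makes the
      last two coordinates coprime integers, with \<rho> = \<open>r / c\<close>.\<close>
    let ?u = "shifted_vector (r / c) (of_int s') (of_int d')"
    have "v = c *s ?u"
      using c by (simp add: rsd scale_shifted_vector)
    then have "?u \<noteq> 0" "vec.span {v} = vec.span {?u}"
      using v span_singleton_scale[OF c(1)] by auto
    then have "X = {vec.span {z} | z. burau_equiv ?u z}"
      using X orbit_span by simp
    then show "QP2_topology closure_of X = topspace QP2_topology"
      by (intro closure_of_burau_orbit[OF c(4)]) auto
  qed
qed

end
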